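(* Let $P\subseteq\mathbb{R}^{p+q}$ be a rational polyhedron. Then $P_I=P^{(1)}_{2^p}$, i.e. the mixed integer hull of $P$ equals the (first) $2^p$-disjunctive closure of $P$.
   Context: $P_I=\mathrm{conv}\{(x,y)\in P: x\in\mathbb{Z}^p\}$. A $k$-disjunction ($k\ge 2$) is a family of $k$ inequalities $d^1x\le\delta^1,\dots,d^kx\le\delta^k$ with $d^i\in\mathbb{Z}^p$ (row vectors, not necessarily distinct) and $\delta^i\in\mathbb{Z}$ such that every $x\in\mathbb{Z}^p$ satisfies $d^ix\le\delta^i$ for at least one $i$. For a closed convex set $C\subseteq\mathbb{R}^{p+q}$, an inequality $\alpha x+\beta y\le\gamma$ is a $k$-disjunctive cut for $C$ if it is not valid for $C$ and there is a $k$-disjunction such that every $(x,y)\in C$ with $\alpha x+\beta y>\gamma$ satisfies $d^ix>\delta^i$ for all $i$. The $k$-disjunctive closure $C^{(1)}_k$ is the intersection of $C$ with all half-spaces $\{\alpha x+\beta y\le\gamma\}$ given by $k$-disjunctive cuts for $C$; iteratively $C^{(0)}_k=C$ and $C^{(i)}_k$ is the $k$-disjunctive closure of $C^{(i-1)}_k$. *)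

theory Defs
  imports Complex_Main
begin

(* Points of R^n are functions nat => real vanishing outside {0..<n}.
   For R^{p+q}: coordinates 0..<p are the x-part (integer-constrained),
   coordinates p..<p+q are the y-part. *)
definition euclid :: "nat \<Rightarrow> (nat \<Rightarrow> real) set" where
  "euclid n = {z. \<forall>i\<ge>n. z i = 0}"

definition lin :: "nat \<Rightarrow> (nat \<Rightarrow> real) \<Rightarrow> (nat \<Rightarrow> real) \<Rightarrow> real" where
  "lin n a z = (\<Sum>j<n. a j * z j)"

definition rational_polyhedron :: "nat \<Rightarrow> (nat \<Rightarrow> real) set \<Rightarrow> bool" where
  "rational_polyhedron n P \<longleftrightarrow>
     (\<exists>(m::nat) (A::nat \<Rightarrow> nat \<Rightarrow> real) (b::nat \<Rightarrow> real).
        (\<forall>j i. A j i \<in> \<rat>) \<and> (\<forall>j. b j \<in> \<rat>) \<and>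
        P = {z \<in> euclid n. \<forall>j<m. lin n (A j) z \<le> b j})"

definition conv_hull :: "(nat \<Rightarrow> real) set \<Rightarrow> (nat \<Rightarrow> real) set" where
  "conv_hull S = {z. \<exists>(k::nat) (u::nat \<Rightarrow> nat \<Rightarrow> real) (w::nat \<Rightarrow> real).
      (\<forall>i<k. u i \<in> S) \<and> (\<forall>i<k. w i \<ge> 0) \<and> (\<Sum>i<k. w i) = 1 \<and>
      z = (\<lambda>j. \<Sum>i<k. w i * u i j)}"

definition mixed_int_hull :: "nat \<Rightarrow> (nat \<Rightarrow> real) set \<Rightarrow> (nat \<Rightarrow> real) set" where
  "mixed_int_hull p P = conv_hull {z \<in> P. \<forall>i<p. z i \<in> \<int>}"

definition is_disjunction :: "nat \<Rightarrow> nat \<Rightarrow> (nat \<Rightarrow> nat \<Rightarrow> int) \<Rightarrow> (nat \<Rightarrow> int) \<Rightarrow> bool" where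
  "is_disjunction p k d \<delta> \<longleftrightarrow> k \<ge> 2 \<and>
     (\<forall>x :: nat \<Rightarrow> int. \<exists>i<k. (\<Sum>j<p. d i j * x j) \<le> \<delta> i)"

definition disj_cut :: "nat \<Rightarrow> nat \<Rightarrow> nat \<Rightarrow> (nat \<Rightarrow> real) set \<Rightarrow> (nat \<Rightarrow> real) \<Rightarrow> real \<Rightarrow> bool" where
  "disj_cut p q k C a \<gamma> \<longleftrightarrow>
     (\<exists>z\<in>C. lin (p+q) a z > \<gamma>) \<and>
     (\<exists>d \<delta>. is_disjunction p k d \<delta> \<and>
        (\<forall>z\<in>C. lin (p+q) a z > \<gamma> \<longrightarrow>
           (\<forall>i<k. (\<Sum>j<p. of_int (d i j) * z j) > of_int (\<delta> i))))"

definition disj_closure :: "nat \<Rightarrow> nat \<Rightarrow> nat \<Rightarrow> (nat \<Rightarrow> real) set \<Rightarrow> (nat \<Rightarrow> real) set" where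
  "disj_closure p q k C = C \<inter> {z. \<forall>a \<gamma>. disj_cut p q k C a \<gamma> \<longrightarrow> lin (p+q) a z \<le> \<gamma>}"

end

theory Submission
  imports Defs
begin

text \<open>By Meyer's theorem the mixed integer hull of \<open>P\<close> is cut out by inequalities \<open>c z \<le> \<gamma>\<close> with
  integral data. If \<open>z \<in> P\<close> violates one of them, pick a rational \<open>g\<close> with \<open>\<gamma> < g < c z\<close>: the rational
  polyhedron \<open>{x \<in> P. c x \<ge> g}\<close> contains no mixed integer point, so its projection to the integer
  coordinates is a rational polyhedron without integer points. Doignon's theorem selects at most
  \<open>2\<^sup>p\<close> of the inequalities of this projection that already exclude every integer point. Their
  negations form the disjunction that makes \<open>c x \<le> g\<close> a cut.\<close>

section \<open>Cones of integer vectors\<close>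

text \<open>The strict gap \<open>\<gamma> < g\<close> replaces the open condition
  \<open>c x > \<gamma>\<close> by a closed one that still excludes every mixed integer point, while
  \<open>g < c z\<close> makes the resulting cut remove \<open>z\<close>. Integral data is kept
  throughout for two reasons. At an integer point a violated integral constraint is violated by at
  least 1, so its negation is again a weak inequality with integer right-hand side. And integer
  multiples of integral rays can be split off a mixed integer point without losing integrality,
  which is what handles unbounded polyhedra in Meyer's theorem. Polyhedra are therefore treated as
  cones cut out by integer vectors, where a single Fourier--Motzkin step yields projections, Weyl's
  theorem and, by duality, Minkowski's. The opposite inclusion is elementary: no cut removes a mixed
  integer point, because its integer coordinates satisfy some inequality of the disjunction.\<close>

definition intvec :: "nat \<Rightarrow> (nat \<Rightarrow> real) set" where
  "intvec n = {z \<in> euclid n. \<forall>i. z i \<in> \<int>}"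

text \<open>The same set is read as the polar cone of \<open>S\<close> and as the solution set of
  the homogeneous system with rows \<open>S\<close>; the duality arguments switch between the two
  readings.\<close>

definition polar :: "nat \<Rightarrow> (nat \<Rightarrow> real) set \<Rightarrow> (nat \<Rightarrow> real) set" where
  "polar n S = {x \<in> euclid n. \<forall>c\<in>S. lin n c x \<le> 0}"

inductive_set cone :: "(nat \<Rightarrow> real) set \<Rightarrow> (nat \<Rightarrow> real) set" for S where
  cone_zero: "(\<lambda>_. 0) \<in> cone S"
| cone_step: "x \<in> cone S \<Longrightarrow> c \<in> S \<Longrightarrow> 0 \<le> r \<Longrightarrow> (\<lambda>i. x i + r * c i) \<in> cone S"

definition unit_vec :: "nat \<Rightarrow> nat \<Rightarrow> real" where
  "unit_vec j = (\<lambda>i. if i = j then 1 else 0)"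

lemma lin_commute: "lin n a b = lin n b a"
  by (simp add: lin_def mult.commute)

lemma lin_comb: "lin n a (\<lambda>i. r * x i + s * y i) = r * lin n a x + s * lin n a y"
  by (simp add: lin_def algebra_simps sum.distrib sum_distrib_left)

lemma lin_comb_left: "lin n (\<lambda>i. r * x i - s * y i) a = r * lin n x a - s * lin n y a"
  by (simp add: lin_def algebra_simps sum_subtractf sum_distrib_left)

lemma lin_add: "lin n a (\<lambda>i. x i + r * y i) = lin n a x + r * lin n a y"
  using lin_comb[of n a 1 x r y] by simp

lemma lin_diff: "lin n a (\<lambda>i. x i - r * y i) = lin n a x - r * lin n a y"
  using lin_comb[of n a 1 x "- r" y] by simp

lemma lin_scale: "lin n a (\<lambda>i. r * x i) = r * lin n a x"
  using lin_comb[of n a r x 0 x] by simp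

lemma lin_zero [simp]: "lin n a (\<lambda>_. 0) = 0"
  by (simp add: lin_def)

lemma lin_unit_vec: "j < n \<Longrightarrow> lin n a (unit_vec j) = a j"
  by (simp add: lin_def unit_vec_def if_distrib cong: if_cong)

lemma lin_Ints: "a \<in> intvec n \<Longrightarrow> b \<in> intvec n \<Longrightarrow> lin n a b \<in> \<int>"
  by (auto simp: lin_def intvec_def intro!: Ints_sum Ints_mult)

lemma unit_vec_intvec: "j < n \<Longrightarrow> unit_vec j \<in> intvec n"
  by (auto simp: intvec_def euclid_def unit_vec_def)

lemma uminus_intvec: "x \<in> intvec n \<Longrightarrow> (\<lambda>i. - x i) \<in> intvec n"
  by (auto simp: intvec_def euclid_def)

lemma lin_uminus: "lin n (\<lambda>i. - a i) x = - lin n a x"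
  by (simp add: lin_def sum_negf)

lemma intvecD: "x \<in> intvec n \<Longrightarrow> x \<in> euclid n"
  by (simp add: intvec_def)

lemma cone_mono: "x \<in> cone S \<Longrightarrow> S \<subseteq> T \<Longrightarrow> x \<in> cone T"
  by (induction rule: cone.induct) (auto intro: cone.intros)

lemma cone_add: "y \<in> cone S \<Longrightarrow> x \<in> cone S \<Longrightarrow> (\<lambda>i. x i + y i) \<in> cone S"
proof (induction rule: cone.induct)
  case (cone_step y c r)
  then have "(\<lambda>i. (x i + y i) + r * c i) \<in> cone S" by (intro cone.cone_step) auto
  then show ?case by (simp add: add.assoc)
qed simp

lemma cone_scale: "x \<in> cone S \<Longrightarrow> 0 \<le> s \<Longrightarrow> (\<lambda>i. s * x i) \<in> cone S"
proof (induction rule: cone.induct)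
  case (cone_step y c r)
  then have "(\<lambda>i. s * y i + (s * r) * c i) \<in> cone S" by (intro cone.cone_step) auto
  then show ?case by (simp add: algebra_simps)
qed (simp add: cone_zero)

lemma cone_base: "c \<in> S \<Longrightarrow> c \<in> cone S"
  using cone_step[OF cone_zero, of c S 1] by simp

text \<open>Brings membership into the shape used in \<open>fourier_motzkin\<close>, so that adding
  a generator becomes one elimination step.\<close>

lemma cone_insert:
  "x \<in> cone (insert g S) \<longleftrightarrow> (\<exists>r\<ge>0. (\<lambda>i. x i - r * g i) \<in> cone S)"
proof
  show "x \<in> cone (insert g S) \<Longrightarrow> \<exists>r\<ge>0. (\<lambda>i. x i - r * g i) \<in> cone S"
  proof (induction rule: cone.induct)
    case cone_zero
    then show ?case using cone.cone_zero by (intro exI[of _ 0]) auto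
  next
    case (cone_step x c s)
    then obtain r where r: "r \<ge> 0" "(\<lambda>i. x i - r * g i) \<in> cone S" by blast
    show ?case
    proof (cases "c = g")
      case True
      with r cone_step show ?thesis
        by (intro exI[of _ "r + s"]) (auto simp: algebra_simps)
    next
      case False
      then have "(\<lambda>i. (x i - r * g i) + s * c i) \<in> cone S"
        using r cone_step by (intro cone.cone_step) auto
      with r show ?thesis by (intro exI[of _ r]) (auto simp: algebra_simps)
    qed
  qed
next
  assume "\<exists>r\<ge>0. (\<lambda>i. x i - r * g i) \<in> cone S"
  then obtain r where r: "r \<ge> 0" "(\<lambda>i. x i - r * g i) \<in> cone S" by blast
  then have "(\<lambda>i. (x i - r * g i) + r * g i) \<in> cone (insert g S)"
    by (intro cone_step) (auto intro: cone_mono)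
  then show "x \<in> cone (insert g S)" by simp
qed

lemma cone_euclid: "x \<in> cone S \<Longrightarrow> S \<subseteq> euclid n \<Longrightarrow> x \<in> euclid n"
  by (induction rule: cone.induct) (auto simp: euclid_def subset_iff)

lemma lin_cone_nonpos:
  "x \<in> cone S \<Longrightarrow> (\<And>c. c \<in> S \<Longrightarrow> lin n a c \<le> 0) \<Longrightarrow> lin n a x \<le> 0"
  by (induction rule: cone.induct) (auto simp: lin_add mult_nonneg_nonpos add_nonpos_nonpos)

lemma cone_sum_form:
  assumes "finite S" "x \<in> cone S"
  shows "\<exists>l. (\<forall>c. 0 \<le> l c) \<and> x = (\<lambda>i. \<Sum>c\<in>S. l c * c i)"
  using assms(2)
proof (induction rule: cone.induct)
  case cone_zero
  show ?case by (intro exI[of _ "\<lambda>_. 0"]) auto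
next
  case (cone_step x c r)
  then obtain l where l: "\<forall>c. 0 \<le> l c" "x = (\<lambda>i. \<Sum>c\<in>S. l c * c i)" by blast
  have "(\<Sum>d\<in>S. (l d + (if d = c then r else 0)) * d i) = x i + r * c i" for i
    using cone_step.hyps assms(1) l(2)
    by (simp add: algebra_simps sum.distrib if_distrib[of "\<lambda>z. _ * z"] cong: if_cong)
  then show ?case using l cone_step.hyps
    by (intro exI[of _ "\<lambda>d. l d + (if d = c then r else 0)"]) auto
qed

lemma sum_in_cone:
  assumes "finite T" "T \<subseteq> S" "\<And>c. c \<in> T \<Longrightarrow> 0 \<le> l c"
  shows "(\<lambda>i. \<Sum>c\<in>T. l c * c i) \<in> cone S"
  using assms
proof (induction rule: finite_induct)
  case empty
  then show ?case by (simp add: cone_zero)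
next
  case (insert c T)
  then have "(\<lambda>i. (\<Sum>c\<in>T. l c * c i) + l c * c i) \<in> cone S"
    by (intro cone_step) auto
  with insert show ?case by (simp add: add.commute)
qed

text \<open>One step of Fourier--Motzkin elimination: the new constraints are the old ones that \<open>g\<close>
  satisfies, and the combinations of a violated with a strictly satisfied one that vanish on \<open>g\<close>.\<close>

lemma fourier_motzkin:
  assumes S: "finite S" "S \<subseteq> intvec n" and g: "g \<in> intvec n"
  obtains S' where "finite S'" "S' \<subseteq> intvec n"
    "\<And>x. x \<in> polar n S' \<longleftrightarrow> x \<in> euclid n \<and> (\<exists>r\<ge>0. (\<lambda>i. x i - r * g i) \<in> polar n S)"
proof -
  define pair where "pair = (\<lambda>c d i. lin n c g * d i - lin n d g * c i)"
  define Pos where "Pos = {c\<in>S. lin n c g > 0}"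
  define Neg where "Neg = {c\<in>S. lin n c g < 0}"
  define S' where "S' = {c\<in>S. lin n c g \<le> 0} \<union> (\<lambda>(c, d). pair c d) ` (Pos \<times> Neg)"
  have fin: "finite Pos" "finite Neg" using S by (auto simp: Pos_def Neg_def)
  have "finite S'" using S fin by (simp add: S'_def)
  moreover have "S' \<subseteq> intvec n"
  proof -
    have "pair c d \<in> intvec n" if "c \<in> S" "d \<in> S" for c d
    proof -
      have "c \<in> intvec n" "d \<in> intvec n" using that S by auto
      then show ?thesis using lin_Ints[OF _ g] by (auto simp: pair_def intvec_def euclid_def)
    qed
    then show ?thesis using S by (auto simp: S'_def Pos_def Neg_def)
  qed
  moreover have "x \<in> polar n S' \<longleftrightarrow> x \<in> euclid n \<and> (\<exists>r\<ge>0. (\<lambda>i. x i - r * g i) \<in> polar n S)" for x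
  proof
    assume x: "x \<in> polar n S'"
    have xe: "x \<in> euclid n" using x by (simp add: polar_def)
    \<comment> \<open>Constraints positive on \<open>g\<close> bound the step from below, those
      negative on \<open>g\<close> bound it from above. The largest lower bound is taken, with 0
      included for \<open>0 \<le> r\<close>.\<close>
    define r where "r = Max (insert 0 ((\<lambda>c. lin n c x / lin n c g) ` Pos))"
    have r0: "0 \<le> r" using fin by (simp add: r_def)
    have "lin n c x \<le> r * lin n c g" if c: "c \<in> S" for c
    proof -
      consider "c \<in> Pos" | "lin n c g = 0" | "c \<in> Neg" using c by (force simp: Pos_def Neg_def)
      then show ?thesis
      proof cases
        case 1
        then have "lin n c x / lin n c g \<le> r" using fin by (simp add: r_def)
        with 1 show ?thesis by (simp add: Pos_def divide_le_eq)
      next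
        case 2
        then have "c \<in> S'" using c by (simp add: S'_def)
        then show ?thesis using x 2 by (simp add: polar_def)
      next
        case 3
        \<comment> \<open>The maximum is attained: either at 0, where \<open>c\<close> itself
          survives in \<open>S'\<close>, or at some \<open>d\<close>, where \<open>pair d c\<close>
          says that the lower bound from \<open>d\<close> does not exceed the upper bound from
          \<open>c\<close>.\<close>
        have "r \<in> insert 0 ((\<lambda>c. lin n c x / lin n c g) ` Pos)"
          unfolding r_def using fin by (intro Max_in) auto
        then consider "r = 0" | d where "d \<in> Pos" "r = lin n d x / lin n d g" by auto
        then show ?thesis
        proof cases
          case 1
          have "c \<in> S'" using 3 by (simp add: S'_def Neg_def)
          then show ?thesis using x 1 by (simp add: polar_def)
        next
          case (2 d)
          then have "pair d c \<in> S'" using 3 by (auto simp: S'_def)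
          then have "lin n (pair d c) x \<le> 0" using x by (auto simp: polar_def)
          then have "lin n d g * lin n c x \<le> lin n c g * lin n d x"
            by (simp add: pair_def lin_comb_left)
          then have "lin n c x * lin n d g \<le> lin n c g * lin n d x" by (simp only: mult.commute)
          then have "lin n c x \<le> lin n c g * lin n d x / lin n d g"
            using 2 by (simp add: Pos_def pos_le_divide_eq)
          then show ?thesis using 2 by (simp add: mult.commute)
        qed
      qed
    qed
    then have "(\<lambda>i. x i - r * g i) \<in> polar n S"
      using xe g by (auto simp: polar_def lin_diff intvec_def euclid_def)
    then show "x \<in> euclid n \<and> (\<exists>r\<ge>0. (\<lambda>i. x i - r * g i) \<in> polar n S)" using r0 xe by blast
  next
    assume "x \<in> euclid n \<and> (\<exists>r\<ge>0. (\<lambda>i. x i - r * g i) \<in> polar n S)"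
    then obtain r where xe: "x \<in> euclid n" and r: "r \<ge> 0"
      and le: "\<And>c. c \<in> S \<Longrightarrow> lin n c x \<le> r * lin n c g"
      by (auto simp: polar_def lin_diff)
    have "lin n c x \<le> 0" if "c \<in> S" "lin n c g \<le> 0" for c
      using le[OF that(1)] mult_nonneg_nonpos[OF r that(2)] by linarith
    moreover have "lin n (pair c d) x \<le> 0" if "c \<in> Pos" "d \<in> Neg" for c d
    proof -
      have "lin n c g * lin n d x \<le> lin n c g * (r * lin n d g)"
        using that le[of d] by (intro mult_left_mono) (auto simp: Pos_def Neg_def)
      moreover have "lin n d g * (r * lin n c g) \<le> lin n d g * lin n c x"
        using that le[of c] by (intro mult_left_mono_neg) (auto simp: Pos_def Neg_def)
      ultimately have "lin n c g * lin n d x - lin n d g * lin n c x \<le> 0"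
        by (simp add: algebra_simps)
      then show ?thesis by (simp add: pair_def lin_comb_left)
    qed
    ultimately show "x \<in> polar n S'" using xe by (auto simp: polar_def S'_def)
  qed
  ultimately show thesis by (rule that)
qed

text \<open>Induction on the generators: each new one extends a cone already described by
  constraints along one direction, and elimination of the multiplier describes the result.\<close>

lemma weyl:
  assumes "finite G" "G \<subseteq> intvec n"
  shows "\<exists>S. finite S \<and> S \<subseteq> intvec n \<and> cone G = polar n S"
  using assms
proof (induction rule: finite_induct)
  case empty
  \<comment> \<open>Both signs of every unit vector leave only the origin.\<close>
  define S where "S = unit_vec ` {..<n} \<union> (\<lambda>j i. - unit_vec j i) ` {..<n}"
  have "x = (\<lambda>_. 0)" if "x \<in> polar n S" for x
  proof
    fix i
    show "x i = 0"
    proof (cases "i < n")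
      case True
      then have "lin n (unit_vec i) x \<le> 0" "lin n (\<lambda>k. - unit_vec i k) x \<le> 0"
        using that by (auto simp: polar_def S_def)
      then show ?thesis
        using True by (simp add: lin_uminus lin_commute[of _ "unit_vec i"] lin_unit_vec)
    next
      case False
      then show ?thesis using that by (auto simp: polar_def euclid_def)
    qed
  qed
  moreover have "x = (\<lambda>_. 0)" if "x \<in> cone {}" for x :: "nat \<Rightarrow> real"
    using that by (induction rule: cone.induct) auto
  moreover have "(\<lambda>_. 0) \<in> polar n S" by (auto simp: polar_def euclid_def)
  ultimately have "cone {} = polar n S" using cone_zero by blast
  moreover have "finite S" "S \<subseteq> intvec n"
    by (auto simp: S_def intro: unit_vec_intvec uminus_intvec)
  ultimately show ?case by blast
next
  case (insert g G)
  then obtain S where S: "finite S" "S \<subseteq> intvec n" "cone G = polar n S" by auto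
  obtain S' where S': "finite S'" "S' \<subseteq> intvec n"
    "\<And>x. x \<in> polar n S' \<longleftrightarrow> x \<in> euclid n \<and> (\<exists>r\<ge>0. (\<lambda>i. x i - r * g i) \<in> polar n S)"
    using fourier_motzkin[OF S(1,2), of g] insert.prems by blast
  have "x \<in> euclid n" if "x \<in> cone (insert g G)" for x
    using cone_euclid[OF that] insert.prems intvecD by blast
  then have "cone (insert g G) = polar n S'"
    using S'(3) S(3) cone_insert[of _ g G] by auto
  then show ?case using S' by blast
qed

lemma polar_cone:
  assumes "S \<subseteq> euclid n"
  shows "polar n (cone S) = polar n S"
proof -
  have "lin n c x \<le> 0" if "c \<in> cone S" "x \<in> polar n S" for c x
    using lin_cone_nonpos[OF that(1), of n x] that(2) by (simp add: polar_def lin_commute)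
  then show ?thesis using cone_base by (fastforce simp: polar_def)
qed

text \<open>Weyl's theorem is applied twice: once to turn \<open>cone S\<close> into the polar of
  some \<open>G\<close>, and once to see that \<open>cone G\<close> is itself a polar and hence
  equals its bipolar.\<close>

lemma minkowski:
  assumes S: "finite S" "S \<subseteq> intvec n"
  shows "\<exists>G. finite G \<and> G \<subseteq> intvec n \<and> polar n S = cone G"
proof -
  obtain G where G: "finite G" "G \<subseteq> intvec n" "cone S = polar n G"
    using weyl[OF S] by blast
  obtain T where T: "finite T" "T \<subseteq> intvec n" "cone G = polar n T"
    using weyl[OF G(1,2)] by blast
  have e: "S \<subseteq> euclid n" "G \<subseteq> euclid n" "T \<subseteq> euclid n" using S G T intvecD by blast+
  have "polar n S = polar n (polar n G)" using polar_cone[OF e(1)] G(3) by simp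
  also have "\<dots> = cone G"
  proof
    have "cone G \<subseteq> euclid n" using cone_euclid e by blast
    moreover have "lin n c x \<le> 0" if "x \<in> cone G" "c \<in> polar n G" for c x
      using lin_cone_nonpos[OF that(1), of n c] that(2) by (simp add: polar_def lin_commute)
    ultimately show "cone G \<subseteq> polar n (polar n G)" by (auto simp: polar_def)
    have "T \<subseteq> polar n (cone G)"
      unfolding T(3) using e(3) by (auto simp: polar_def lin_commute)
    then have "T \<subseteq> polar n G" using polar_cone[OF e(2)] by simp
    then show "polar n (polar n G) \<subseteq> cone G" unfolding T(3) by (auto simp: polar_def)
  qed
  finally show ?thesis using G by blast
qed

text \<open>Forgetting coordinate \<open>j\<close> means moving freely along its axis, but an
  elimination step allows only nonnegative multiples of one direction. Two steps, along
  \<open>unit_vec j\<close> and its negative, give both signs.\<close>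

lemma polar_projection:
  assumes "finite J" "finite S" "S \<subseteq> intvec n" "J \<subseteq> {..<n}"
  shows "\<exists>S'. finite S' \<and> S' \<subseteq> intvec n \<and>
    (\<forall>x. x \<in> polar n S' \<longleftrightarrow> x \<in> euclid n \<and> (\<exists>y\<in>polar n S. \<forall>i. i \<notin> J \<longrightarrow> y i = x i))"
  using assms(1,4)
proof (induction rule: finite_induct)
  case empty
  have "y = x" if "\<forall>i. y i = x i" for x y :: "nat \<Rightarrow> real" using that by auto
  then show ?case using assms by (intro exI[of _ S]) (auto simp: polar_def)
next
  case (insert j J)
  then obtain S1 where S1: "finite S1" "S1 \<subseteq> intvec n"
    "\<And>x. x \<in> polar n S1 \<longleftrightarrow> x \<in> euclid n \<and> (\<exists>y\<in>polar n S. \<forall>i. i \<notin> J \<longrightarrow> y i = x i)"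
    by auto
  have j: "j < n" using insert by auto
  obtain S2 where S2: "finite S2" "S2 \<subseteq> intvec n"
    "\<And>x. x \<in> polar n S2 \<longleftrightarrow> x \<in> euclid n \<and> (\<exists>r\<ge>0. (\<lambda>i. x i - r * unit_vec j i) \<in> polar n S1)"
    using fourier_motzkin[OF S1(1,2) unit_vec_intvec[OF j]] by blast
  obtain S3 where S3: "finite S3" "S3 \<subseteq> intvec n"
    "\<And>x. x \<in> polar n S3 \<longleftrightarrow> x \<in> euclid n \<and> (\<exists>r\<ge>0. (\<lambda>i. x i - r * - unit_vec j i) \<in> polar n S2)"
    using fourier_motzkin[OF S2(1,2) uminus_intvec[OF unit_vec_intvec[OF j]]] by blast
  have "x \<in> polar n S3 \<longleftrightarrow> x \<in> euclid n \<and> (\<exists>y\<in>polar n S. \<forall>i. i \<notin> insert j J \<longrightarrow> y i = x i)" for x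
  proof
    assume "x \<in> polar n S3"
    then obtain r where x: "x \<in> euclid n" "(\<lambda>i. x i - r * - unit_vec j i) \<in> polar n S2"
      using S3(3) by blast
    then obtain s where "(\<lambda>i. (x i - r * - unit_vec j i) - s * unit_vec j i) \<in> polar n S1"
      using S2(3)[of "\<lambda>i. x i - r * - unit_vec j i"] by blast
    then have "\<exists>y\<in>polar n S. \<forall>i. i \<notin> J \<longrightarrow> y i = (x i - r * - unit_vec j i) - s * unit_vec j i"
      by (simp only: S1(3))
    then obtain y where "y \<in> polar n S"
      "\<forall>i. i \<notin> J \<longrightarrow> y i = (x i - r * - unit_vec j i) - s * unit_vec j i" ..
    with x show "x \<in> euclid n \<and> (\<exists>y\<in>polar n S. \<forall>i. i \<notin> insert j J \<longrightarrow> y i = x i)"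
      by (auto simp: unit_vec_def intro!: bexI[of _ y])
  next
    assume "x \<in> euclid n \<and> (\<exists>y\<in>polar n S. \<forall>i. i \<notin> insert j J \<longrightarrow> y i = x i)"
    then obtain y where x: "x \<in> euclid n" and y: "y \<in> polar n S"
      "\<And>i. i \<notin> insert j J \<Longrightarrow> y i = x i" by blast
    \<comment> \<open>Positive and negative part of the displacement from \<open>x j\<close> to
      \<open>y j\<close>.\<close>
    define r where "r = max 0 (y j - x j)"
    define s where "s = max 0 (x j - y j)"
    have rs: "0 \<le> r" "0 \<le> s" "x j + r - s = y j" by (auto simp: r_def s_def)
    let ?u = "\<lambda>i. x i - r * - unit_vec j i"
    have "?u \<in> euclid n" "(\<lambda>i. ?u i - s * unit_vec j i) \<in> euclid n"
      using x j by (auto simp: euclid_def unit_vec_def)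
    moreover have "\<exists>y\<in>polar n S. \<forall>i. i \<notin> J \<longrightarrow> y i = ?u i - s * unit_vec j i"
      using y rs by (intro bexI[of _ y]) (auto simp: unit_vec_def)
    ultimately have "(\<lambda>i. ?u i - s * unit_vec j i) \<in> polar n S1" by (simp only: S1(3))
    with \<open>?u \<in> euclid n\<close> have "?u \<in> polar n S2" using S2(3)[of ?u] rs by blast
    then show "x \<in> polar n S3" using S3(3)[of x] rs x by blast
  qed
  then show ?case using S3(1,2) by blast
qed

section \<open>Convex hulls\<close>

definition convex_fun :: "(nat \<Rightarrow> real) set \<Rightarrow> bool" where
  "convex_fun C \<longleftrightarrow>
    (\<forall>x\<in>C. \<forall>y\<in>C. \<forall>s t. 0 \<le> s \<longrightarrow> 0 \<le> t \<longrightarrow> s + t = 1 \<longrightarrow> (\<lambda>i. s * x i + t * y i) \<in> C)"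

lemma convex_funD:
  "convex_fun C \<Longrightarrow> x \<in> C \<Longrightarrow> y \<in> C \<Longrightarrow> 0 \<le> s \<Longrightarrow> 0 \<le> t \<Longrightarrow> s + t = 1
    \<Longrightarrow> (\<lambda>i. s * x i + t * y i) \<in> C"
  by (simp add: convex_fun_def)

lemma convex_fun_comb:
  fixes w :: "nat \<Rightarrow> real"
  assumes C: "convex_fun C" and "\<forall>i<k. u i \<in> C" "\<forall>i<k. 0 \<le> w i" "(\<Sum>i<k. w i) = 1"
  shows "(\<lambda>j. \<Sum>i<k. w i * u i j) \<in> C"
  using assms(2-)
proof (induction k arbitrary: w)
  case (Suc k)
  define s where "s = (\<Sum>i<k. w i)"
  have s: "0 \<le> s" "s + w k = 1" using Suc.prems by (auto simp: s_def intro!: sum_nonneg)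
  show ?case
  proof (cases "s = 0")
    case True
    then have "\<forall>i<k. w i = 0"
      using Suc.prems(2) sum_nonneg_eq_0_iff[of "{..<k}" w] by (auto simp: s_def)
    with True s Suc.prems show ?thesis by simp
  next
    case False
    then have "(\<lambda>j. \<Sum>i<k. w i / s * u i j) \<in> C"
      using Suc s by (intro Suc.IH) (auto simp flip: sum_divide_distrib simp: s_def)
    then have "(\<lambda>j. s * (\<Sum>i<k. w i / s * u i j) + w k * u k j) \<in> C"
      using Suc.prems s by (intro convex_funD[OF C]) auto
    with False show ?thesis by (simp add: sum_distrib_left)
  qed
qed simp

lemma conv_hull_minimal: "S \<subseteq> C \<Longrightarrow> convex_fun C \<Longrightarrow> conv_hull S \<subseteq> C"
  using convex_fun_comb unfolding conv_hull_def by blast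

lemma conv_hull_superset: "S \<subseteq> conv_hull S"
proof
  fix x assume "x \<in> S"
  then show "x \<in> conv_hull S" unfolding conv_hull_def
    by (intro CollectI exI[of _ 1] exI[of _ "\<lambda>_. x"] exI[of _ "\<lambda>_. 1"]) auto
qed

text \<open>The two families of points are concatenated, with weights scaled by \<open>s\<close> and
  \<open>t\<close>.\<close>

lemma convex_conv_hull: "convex_fun (conv_hull S)"
  unfolding convex_fun_def
proof (intro ballI allI impI)
  fix x y :: "nat \<Rightarrow> real" and s t :: real
  assume "x \<in> conv_hull S" "y \<in> conv_hull S" and st: "0 \<le> s" "0 \<le> t" "s + t = 1"
  then obtain k1 u1 w1 k2 u2 w2 where
    x: "\<forall>i<k1. u1 i \<in> S" "\<forall>i<k1. w1 i \<ge> 0" "(\<Sum>i<k1. w1 i) = 1"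
      "x = (\<lambda>j. \<Sum>i<(k1::nat). w1 i * u1 i j)" and
    y: "\<forall>i<k2. u2 i \<in> S" "\<forall>i<k2. w2 i \<ge> 0" "(\<Sum>i<k2. w2 i) = 1"
      "y = (\<lambda>j. \<Sum>i<(k2::nat). w2 i * u2 i j)"
    unfolding conv_hull_def by blast
  define u where "u = (\<lambda>i. if i < k1 then u1 i else u2 (i - k1))"
  define w where "w = (\<lambda>i. if i < k1 then s * w1 i else t * w2 (i - k1))"
  have split: "(\<Sum>i<k1+k2. f i) = (\<Sum>i<k1. f i) + (\<Sum>i<k2. f (i + k1))" for f :: "nat \<Rightarrow> real"
  proof -
    have "{..<k1+k2} = {..<k1} \<union> {k1..<k1+k2}" by auto
    then have "(\<Sum>i<k1+k2. f i) = (\<Sum>i<k1. f i) + (\<Sum>i=k1..<k1+k2. f i)"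
      by (simp add: sum.union_disjoint ivl_disj_int)
    moreover have "(\<Sum>i=k1..<k1+k2. f i) = (\<Sum>i<k2. f (i + k1))"
      using sum.shift_bounds_nat_ivl[of f 0 k1 k2] by (simp add: lessThan_atLeast0 add.commute)
    ultimately show ?thesis by simp
  qed
  have "(\<Sum>i<k1+k2. w i) = 1"
    using x(3) y(3) st by (simp add: split w_def flip: sum_distrib_left)
  moreover have "(\<lambda>j. s * x j + t * y j) = (\<lambda>j. \<Sum>i<k1+k2. w i * u i j)"
    by (simp add: split w_def u_def x(4) y(4) sum_distrib_left mult.assoc)
  ultimately show "(\<lambda>i. s * x i + t * y i) \<in> conv_hull S"
    unfolding conv_hull_def using x y st
    by (intro CollectI exI[of _ "k1+k2"] exI[of _ u] exI[of _ w]) (auto simp: u_def w_def)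
qed

section \<open>Doignon's theorem\<close>

text \<open>A disjunction with an arbitrary index set and no condition on its size; later the
  constraint vectors themselves serve as indices.\<close>

definition covers :: "nat \<Rightarrow> ('a \<Rightarrow> nat \<Rightarrow> int) \<Rightarrow> ('a \<Rightarrow> int) \<Rightarrow> 'a set \<Rightarrow> bool" where
  "covers p d \<delta> I \<longleftrightarrow> (\<forall>x :: nat \<Rightarrow> int. \<exists>i\<in>I. (\<Sum>j<p. d i j * x j) \<le> \<delta> i)"

text \<open>Lower the right-hand sides as far as the inequalities still cover the integer points. Each
  inequality is then the only one satisfied at some integer point, and it is tight there. If two such
  points had the same parity, their midpoint would be an uncovered integer point.\<close>

lemma minimal_cover_card:
  fixes d :: "'a \<Rightarrow> nat \<Rightarrow> int"
  assumes fin: "finite I" and cov: "covers p d \<delta> I" and min: "\<And>i. i \<in> I \<Longrightarrow> \<not> covers p d \<delta> (I - {i})"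
  shows "card I \<le> 2 ^ p"
proof -
  define L where "L = (\<lambda>i (x :: nat \<Rightarrow> int). \<Sum>j<p. d i j * x j)"
  have cov': "covers p d g K \<longleftrightarrow> (\<forall>x. \<exists>i\<in>K. L i x \<le> g i)" for g K
    by (simp add: covers_def L_def)
  have "\<forall>i\<in>I. \<exists>x. \<forall>k\<in>I - {i}. L k x > \<delta> k" using min by (force simp: cov' not_le)
  \<comment> \<open>\<open>X i\<close> is an integer point that is lost when \<open>i\<close> is
    dropped.\<close>
  then obtain X where X: "\<And>i k. i \<in> I \<Longrightarrow> k \<in> I \<Longrightarrow> k \<noteq> i \<Longrightarrow> L k (X i) > \<delta> k"
    by (metis Diff_iff singletonD)
  define U where "U = {g. (\<forall>i\<in>I. g i \<le> \<delta> i) \<and> covers p d g I}"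
  \<comment> \<open>However the right-hand sides are lowered, only \<open>i\<close> can cover
    \<open>X i\<close>. This bounds the lowering and guarantees that a lowest choice exists.\<close>
  have lower: "L i (X i) \<le> g i" if "g \<in> U" "i \<in> I" for g i
  proof -
    obtain k where "k \<in> I" "L k (X i) \<le> g k" using \<open>g \<in> U\<close> by (auto simp: U_def cov')
    moreover have "g k \<le> \<delta> k" using \<open>g \<in> U\<close> \<open>k \<in> I\<close> by (auto simp: U_def)
    ultimately show ?thesis using X[OF \<open>i \<in> I\<close>, of k] by (cases "k = i") auto
  qed
  \<comment> \<open>Total distance to these bounds; it is nonnegative on \<open>U\<close>, so
    \<open>nat\<close> loses nothing there.\<close>
  define m where "m = (\<lambda>g. nat (\<Sum>i\<in>I. g i - L i (X i)))"
  have "\<delta> \<in> U" using cov by (auto simp: U_def)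
  then obtain g where g: "g \<in> U" and gmin: "\<And>h. h \<in> U \<Longrightarrow> m g \<le> m h"
    using ex_has_least_nat[of "\<lambda>h. h \<in> U" \<delta> m] by blast
  have "\<exists>y. L i y = g i \<and> (\<forall>k\<in>I - {i}. L k y > g k)" if i: "i \<in> I" for i
  proof -
    \<comment> \<open>By minimality one further unit at \<open>i\<close> uncovers some
      \<open>y\<close>. Since \<open>g\<close> still covers \<open>y\<close>, integrality forces
      \<open>L i y = g i\<close>.\<close>
    define h where "h = g(i := g i - 1)"
    have sum: "(\<Sum>k\<in>I. h k - L k (X k)) = (\<Sum>k\<in>I. g k - L k (X k)) - 1"
      using fin i by (simp add: sum.remove[OF fin i] h_def)
    have "h \<notin> U"
    proof
      assume h: "h \<in> U"
      have "0 \<le> (\<Sum>k\<in>I. h k - L k (X k))" by (intro sum_nonneg) (simp add: lower[OF h])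
      then have "m h < m g" using sum by (simp add: m_def)
      then show False using gmin[OF h] by simp
    qed
    moreover have "\<forall>k\<in>I. h k \<le> \<delta> k" using g by (auto simp: U_def h_def)
    ultimately obtain y where y: "\<And>k. k \<in> I \<Longrightarrow> h k < L k y" by (auto simp: U_def cov' not_le)
    have 1: "\<forall>k\<in>I - {i}. L k y > g k" using y unfolding h_def by (metis DiffE fun_upd_other insertCI)
    obtain k where "k \<in> I" "L k y \<le> g k" using g by (auto simp: U_def cov')
    then have "L i y \<le> g i" using 1 by (cases "k = i") force+
    with y[OF i] 1 show ?thesis by (force simp: h_def)
  qed
  then obtain Y where Y: "\<And>i. i \<in> I \<Longrightarrow> L i (Y i) = g i"
    "\<And>i k. i \<in> I \<Longrightarrow> k \<in> I \<Longrightarrow> k \<noteq> i \<Longrightarrow> L k (Y i) > g k"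
    by (metis Diff_iff singletonD)
  define par where "par = (\<lambda>i. {j\<in>{..<p}. odd (Y i j)})"
  have "inj_on par I"
  proof (rule inj_onI, rule ccontr)
    fix a b assume ab: "a \<in> I" "b \<in> I" "par a = par b" "a \<noteq> b"
    define z where "z = (\<lambda>j. (Y a j + Y b j) div 2)"
    have z: "2 * z j = Y a j + Y b j" if "j < p" for j
    proof -
      have "odd (Y a j) \<longleftrightarrow> odd (Y b j)" using ab(3) that by (auto simp: par_def set_eq_iff)
      then show ?thesis by (simp add: z_def)
    qed
    have Lz: "2 * L i z = L i (Y a) + L i (Y b)" for i
    proof -
      have "2 * L i z = (\<Sum>j<p. d i j * (2 * z j))"
        by (simp add: L_def sum_distrib_left mult.left_commute)
      also have "\<dots> = (\<Sum>j<p. d i j * (Y a j + Y b j))" by (intro sum.cong) (auto simp: z)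
      finally show ?thesis by (simp add: L_def algebra_simps sum.distrib)
    qed
    obtain i where i: "i \<in> I" "L i z \<le> g i" using g by (auto simp: U_def cov')
    \<comment> \<open>\<open>i\<close> differs from \<open>a\<close> or from \<open>b\<close>, so
      one of the values is strict and the average exceeds \<open>g i\<close>.\<close>
    have "L i (Y a) \<ge> g i" "L i (Y b) \<ge> g i" "L i (Y a) > g i \<or> L i (Y b) > g i"
      using Y(1)[of i] Y(2)[OF ab(1) i(1)] Y(2)[OF ab(2) i(1)] ab(4) i(1)
      by (cases "i = a"; cases "i = b"; force)+
    then show False using Lz[of i] i by linarith
  qed
  then have "card I \<le> card (Pow {..<p})"
    by (rule card_inj_on_le) (auto simp: par_def)
  then show ?thesis by (simp add: card_Pow)
qed

text \<open>A covering subfamily of least cardinality is irredundant.\<close>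

lemma doignon:
  assumes "finite I" "covers p d \<delta> I"
  shows "\<exists>K\<subseteq>I. covers p d \<delta> K \<and> card K \<le> 2 ^ p"
proof -
  obtain K where K: "K \<subseteq> I" "covers p d \<delta> K"
    and least: "\<And>K'. K' \<subseteq> I \<and> covers p d \<delta> K' \<Longrightarrow> card K \<le> card K'"
    using ex_has_least_nat[of "\<lambda>K. K \<subseteq> I \<and> covers p d \<delta> K" I card] assms by blast
  have fin: "finite K" using K assms finite_subset by blast
  have "\<not> covers p d \<delta> (K - {i})" if "i \<in> K" for i
    using least[of "K - {i}"] K(1) card_Diff1_less[OF fin that] by (auto simp: not_le)
  then show ?thesis using minimal_cover_card[OF fin K(2)] K by blast
qed

section \<open>The mixed integer hull is a rational polyhedron\<close>

text \<open>Coordinate \<open>n\<close> homogenises the polyhedra of \<open>\<real>\<^sup>n\<close>.\<close>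

definition slice :: "nat \<Rightarrow> (nat \<Rightarrow> real) set \<Rightarrow> (nat \<Rightarrow> real) set" where
  "slice n S = {z \<in> euclid n. z(n := 1) \<in> polar (Suc n) S}"

text \<open>Rescales a point with \<open>x n > 0\<close> to height 1 and then resets coordinate
  \<open>n\<close> to 0, so that the result lies in \<open>euclid n\<close>.\<close>

definition dehom :: "nat \<Rightarrow> (nat \<Rightarrow> real) \<Rightarrow> nat \<Rightarrow> real" where
  "dehom n x = (\<lambda>i. if i = n then 0 else x i / x n)"

lemma lin_Suc: "lin (Suc n) c x = lin n c x + c n * x n"
  by (simp add: lin_def)

lemma lin_upd [simp]: "lin n c (z(n := t)) = lin n c z"
  by (simp add: lin_def)

lemma mem_slice: "z \<in> slice n S \<longleftrightarrow> z \<in> euclid n \<and> (\<forall>c\<in>S. lin n c z + c n \<le> 0)"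
  by (auto simp: slice_def polar_def lin_Suc euclid_def)

lemma convex_slice: "convex_fun (slice n S)"
  unfolding convex_fun_def
proof (intro ballI allI impI)
  fix x y :: "nat \<Rightarrow> real" and s t :: real
  assume xy: "x \<in> slice n S" "y \<in> slice n S" and st: "0 \<le> s" "0 \<le> t" "s + t = 1"
  have "lin n c (\<lambda>i. s * x i + t * y i) + c n \<le> 0" if "c \<in> S" for c
  proof -
    have "s * (lin n c x + c n) + t * (lin n c y + c n) \<le> 0"
      using xy st that by (auto simp: mem_slice intro!: add_nonpos_nonpos[of "s * _"] mult_nonneg_nonpos)
    moreover have "s * c n + t * c n = c n" using st by (simp flip: distrib_right)
    ultimately show ?thesis by (simp add: lin_comb algebra_simps)
  qed
  then show "(\<lambda>i. s * x i + t * y i) \<in> slice n S" using xy by (auto simp: mem_slice euclid_def)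
qed

lemma dehom_slice:
  assumes "x \<in> polar (Suc n) S" "x n > 0"
  shows "dehom n x \<in> slice n S"
proof -
  have "lin n c (dehom n x) + c n \<le> 0" if "c \<in> S" for c
  proof -
    have "lin n c (dehom n x) = lin n c x / x n"
      by (simp add: lin_def dehom_def sum_divide_distrib)
    moreover have "lin n c x + c n * x n \<le> 0"
      using assms(1) that by (simp add: polar_def lin_Suc)
    moreover have "lin n c x / x n + c n = (lin n c x + c n * x n) / x n"
      using assms(2) by (simp add: add_divide_distrib)
    ultimately show ?thesis using assms(2) by (simp add: divide_nonpos_pos)
  qed
  then show ?thesis using assms(1) by (auto simp: mem_slice dehom_def euclid_def polar_def)
qed

lemma rational_common_denominator:
  fixes v :: "nat \<Rightarrow> real"
  assumes "\<And>i. v i \<in> \<rat>"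
  shows "\<exists>k>0. k \<in> \<int> \<and> (\<forall>i<n. k * v i \<in> \<int>)"
proof (induction n)
  case 0
  show ?case by (intro exI[of _ 1]) auto
next
  case (Suc n)
  then obtain k where k: "k > 0" "k \<in> \<int>" "\<forall>i<n. k * v i \<in> \<int>" by blast
  obtain a b where ab: "b > 0" "v n = of_int a / of_int b"
    using assms[of n] by (auto elim: Rats_cases')
  have "k * of_int b * v i \<in> \<int>" if "i < Suc n" for i
  proof (cases "i = n")
    case True
    then show ?thesis using ab k by simp
  next
    case False
    then have "k * v i \<in> \<int>" using that k by simp
    then have "k * v i * of_int b \<in> \<int>" by (rule Ints_mult) simp
    then show ?thesis by (simp add: mult_ac)
  qed
  then show ?case using k ab by (intro exI[of _ "k * of_int b"]) auto
qed

text \<open>The constraint \<open>-unit_vec n\<close> restricts the homogenisation to nonnegative last coordinate.\<close>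

lemma rational_polyhedron_slice:
  assumes "rational_polyhedron n P"
  obtains S where "finite S" "S \<subseteq> intvec (Suc n)" "(\<lambda>i. - unit_vec n i) \<in> S" "P = slice n S"
proof -
  obtain m A b where rat: "\<And>j i. A j i \<in> \<rat>" "\<And>j. b j \<in> \<rat>"
    and P: "P = {z \<in> euclid n. \<forall>j<(m::nat). lin n (A j) z \<le> b j}"
    using assms unfolding rational_polyhedron_def by blast
  have "\<exists>k>0. k \<in> \<int> \<and> (\<forall>i<Suc n. k * (if i < n then A j i else b j) \<in> \<int>)" for j
    using rat by (intro rational_common_denominator) auto
  then obtain k where k: "\<And>j. k j > 0"
    "\<And>j i. i < Suc n \<Longrightarrow> k j * (if i < n then A j i else b j) \<in> \<int>" by metis
  define row where "row = (\<lambda>j i. if i < n then k j * A j i else if i = n then - (k j * b j) else 0)"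
  define S where "S = insert (\<lambda>i. - unit_vec n i) (row ` {..<m})"
  have "row j i \<in> \<int>" for j i using k(2)[of i j] by (auto simp: row_def split: if_splits)
  then have "row j \<in> intvec (Suc n)" for j
    by (auto simp: intvec_def euclid_def) (auto simp: row_def)
  then have "S \<subseteq> intvec (Suc n)" by (auto simp: S_def intro: uminus_intvec unit_vec_intvec)
  moreover have "P = slice n S"
  proof -
    have "lin n (row j) z + row j n \<le> 0 \<longleftrightarrow> lin n (A j) z \<le> b j" for j z
    proof -
      have "lin n (row j) z = k j * lin n (A j) z"
        by (simp add: lin_def row_def sum_distrib_left mult.assoc)
      then show ?thesis using k(1)[of j] by (simp add: row_def)
    qed
    moreover have "lin n (\<lambda>i. - unit_vec n i) z = 0" for z
      by (simp add: lin_def unit_vec_def)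
    moreover have "unit_vec n n = 1" by (simp add: unit_vec_def)
    ultimately show ?thesis by (auto simp: P mem_slice S_def)
  qed
  ultimately show thesis using that[of S] by (simp add: S_def)
qed

text \<open>For an integer \<open>N > \<mu>\<close>, a mixed integer point \<open>u\<close> lies
  with \<open>u + N c\<close> in the hull, hence so does \<open>u + \<mu> c\<close> between them.
  The points whose translate by \<open>\<mu> c\<close> lies in the hull form a convex set, so the
  claim passes from \<open>u\<close> to the whole hull.\<close>

lemma mixed_int_hull_ray:
  assumes c: "c \<in> polar (Suc n) S" "c \<in> intvec (Suc n)" "c n = 0" and mu: "0 \<le> \<mu>"
    and v: "v \<in> mixed_int_hull p (slice n S)"
  shows "(\<lambda>i. v i + \<mu> * c i) \<in> mixed_int_hull p (slice n S)"
proof -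
  define M where "M = {z \<in> slice n S. \<forall>i<p. z i \<in> \<int>}"
  define C where "C = {v. (\<lambda>i. v i + \<mu> * c i) \<in> conv_hull M}"
  have "u \<in> C" if u: "u \<in> M" for u
  proof -
    obtain N :: nat where N: "\<mu> < of_nat N" using reals_Archimedean2 by blast
    define u' where "u' = (\<lambda>i. u i + of_nat N * c i)"
    have "lin n d u' + d n \<le> 0" if "d \<in> S" for d
    proof -
      have "lin n d c \<le> 0" using c that by (auto simp: polar_def lin_Suc)
      then have "of_nat N * lin n d c \<le> 0" by (simp add: mult_nonneg_nonpos)
      moreover have "lin n d u + d n \<le> 0" using u that by (simp add: M_def mem_slice)
      ultimately show ?thesis by (simp add: u'_def lin_add)
    qed
    moreover have "u' \<in> euclid n"
    proof -
      have "c i = 0" if "i \<ge> n" for i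
        using that c by (cases "i = n") (auto simp: intvec_def euclid_def)
      then show ?thesis using u by (simp add: u'_def M_def mem_slice euclid_def)
    qed
    moreover have "u' i \<in> \<int>" if "i < p" for i
      using u c that by (auto simp: u'_def M_def intvec_def)
    ultimately have "u' \<in> M" by (simp add: M_def mem_slice)
    then have "(\<lambda>i. (1 - \<mu> / of_nat N) * u i + \<mu> / of_nat N * u' i) \<in> conv_hull M"
      using u mu N conv_hull_superset[of M]
      by (intro convex_funD[OF convex_conv_hull]) (auto simp: divide_le_eq)
    moreover have "(1 - \<mu> / of_nat N) * u i + \<mu> / of_nat N * u' i = u i + \<mu> * c i" for i
      using N mu by (simp add: u'_def field_simps)
    ultimately show ?thesis by (simp add: C_def)
  qed
  moreover have "convex_fun C"
    unfolding convex_fun_def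
  proof (intro ballI allI impI)
    fix x y :: "nat \<Rightarrow> real" and s t :: real
    assume xy: "x \<in> C" "y \<in> C" and st: "0 \<le> s" "0 \<le> t" "s + t = 1"
    then have "(\<lambda>i. s * (x i + \<mu> * c i) + t * (y i + \<mu> * c i)) \<in> conv_hull M"
      by (intro convex_funD[OF convex_conv_hull]) (auto simp: C_def)
    moreover have "s * (x i + \<mu> * c i) + t * (y i + \<mu> * c i)
        = (s * x i + t * y i) + (s + t) * (\<mu> * c i)" for i by (simp add: algebra_simps)
    ultimately show "(\<lambda>i. s * x i + t * y i) \<in> C" using st by (simp add: C_def)
  qed
  ultimately have "conv_hull M \<subseteq> C" by (intro conv_hull_minimal) auto
  then show ?thesis using v by (auto simp: mixed_int_hull_def M_def C_def)
qed

text \<open>Multipliers of the rays (\<open>g n = 0\<close>) are split into floor and fractional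
  part; all multipliers left in \<open>w\<close> are then at most 1, which confines \<open>w\<close>
  to a box depending on \<open>G\<close> alone.\<close>

lemma cone_integral_split:
  assumes G: "finite G" "G \<subseteq> intvec (Suc n)" "\<And>g. g \<in> G \<Longrightarrow> 0 \<le> g n"
    and x: "x \<in> cone G" "x n = 1"
  obtains w u where "w \<in> cone G" "u \<in> cone {g\<in>G. g n = 0}" "\<And>i. u i \<in> \<int>"
    "x = (\<lambda>i. w i + u i)" "\<And>i. \<bar>w i\<bar> \<le> (\<Sum>g\<in>G. \<bar>g i\<bar>)"
proof -
  obtain l where l: "\<And>c. 0 \<le> l c" "x = (\<lambda>i. \<Sum>c\<in>G. l c * c i)"
    using cone_sum_form[OF G(1) x(1)] by blast
  define f where "f = (\<lambda>g. if g n = 0 then frac (l g) else l g)"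
  define w where "w = (\<lambda>i. \<Sum>g\<in>G. f g * g i)"
  define u where "u = (\<lambda>i. \<Sum>g\<in>{g\<in>G. g n = 0}. of_int \<lfloor>l g\<rfloor> * g i)"
  have f0: "0 \<le> f g" for g using l by (simp add: f_def)
  have f1: "f g \<le> 1" if g: "g \<in> G" for g
  proof (cases "g n = 0")
    case True
    then show ?thesis by (simp add: f_def frac_lt_1 less_imp_le)
  next
    case False
    \<comment> \<open>A positive integral height is at least 1, and the heights sum to
      \<open>x n = 1\<close>, so the multiplier cannot exceed 1.\<close>
    obtain k where k: "g n = of_int k" using G(2) g by (auto simp: intvec_def elim!: Ints_cases)
    then have "1 \<le> g n" using False G(3)[OF g] by simp
    then have "l g \<le> l g * g n" using l(1)[of g] by (simp add: mult_le_cancel_left1)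
    also have "\<dots> \<le> (\<Sum>c\<in>G. l c * c n)"
      using G g l(1) by (intro member_le_sum) auto
    also have "\<dots> = 1" using x(2) l(2) by simp
    finally show ?thesis using False by (simp add: f_def)
  qed
  have "w \<in> cone G" unfolding w_def using G f0 by (intro sum_in_cone) auto
  moreover have "u \<in> cone {g\<in>G. g n = 0}"
    unfolding u_def using G l(1) by (intro sum_in_cone) auto
  moreover have "u i \<in> \<int>" for i
    unfolding u_def using G(2) by (intro Ints_sum Ints_mult) (auto simp: intvec_def)
  moreover have "x = (\<lambda>i. w i + u i)"
  proof
    fix i
    have "u i = (\<Sum>g\<in>G. if g n = 0 then of_int \<lfloor>l g\<rfloor> * g i else 0)"
      unfolding u_def using G(1) by (intro sum.mono_neutral_cong_left) auto
    then have "w i + u i = (\<Sum>g\<in>G. f g * g i + (if g n = 0 then of_int \<lfloor>l g\<rfloor> * g i else 0))"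
      by (simp add: w_def sum.distrib)
    also have "\<dots> = (\<Sum>g\<in>G. l g * g i)"
      by (intro sum.cong) (auto simp: f_def frac_def algebra_simps)
    finally show "x i = w i + u i" using l(2) by simp
  qed
  moreover have "\<bar>w i\<bar> \<le> (\<Sum>g\<in>G. \<bar>g i\<bar>)" for i
    unfolding w_def
  proof (rule order.trans[OF sum_abs sum_mono])
    fix g assume "g \<in> G"
    then show "\<bar>f g * g i\<bar> \<le> \<bar>g i\<bar>"
      using f0[of g] f1[of g] by (simp add: abs_mult mult_left_le_one_le)
  qed
  ultimately show thesis by (rule that)
qed

text \<open>At height 0 the induction must remember that only rays have been used: they are attached
  to the first generator of positive height once it arrives.\<close>

lemma cone_dehom_hull:
  assumes T: "\<And>g. g \<in> T \<Longrightarrow> g \<in> intvec (Suc n)" "\<And>g. g \<in> T \<Longrightarrow> g \<in> polar (Suc n) S"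
      "\<And>g. g \<in> T \<Longrightarrow> 0 \<le> g n"
    and pts: "\<And>g. g \<in> T \<Longrightarrow> 0 < g n \<Longrightarrow> dehom n g \<in> mixed_int_hull p (slice n S)"
    and x: "x \<in> cone T"
  shows "x n = 0 \<and> x \<in> cone {g\<in>T. g n = 0} \<or> x n > 0 \<and> dehom n x \<in> mixed_int_hull p (slice n S)"
proof -
  let ?H = "mixed_int_hull p (slice n S)" and ?R = "{g\<in>T. g n = 0}"
  have ray: "(\<lambda>i. v i + \<mu> * g i) \<in> ?H" if "v \<in> ?H" "g \<in> ?R" "0 \<le> \<mu>" for v g \<mu>
    using mixed_int_hull_ray[of g n S \<mu> v p] T that by auto
  have rays: "(\<lambda>i. v i + y i) \<in> ?H" if "y \<in> cone ?R" "v \<in> ?H" for y v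
    using that
  proof (induction rule: cone.induct)
    case (cone_step y c r)
    then have "(\<lambda>i. (v i + y i) + r * c i) \<in> ?H" by (intro ray) auto
    then show ?case by (simp add: add.assoc)
  qed simp
  show ?thesis using x
  proof (induction rule: cone.induct)
    case cone_zero
    then show ?case by (simp add: cone.cone_zero)
  next
    case (cone_step x c r)
    let ?x = "\<lambda>i. x i + r * c i"
    have c0: "0 \<le> c n" using T(3) cone_step.hyps by blast
    consider "r = 0" | "c n = 0" "x n = 0" | "r > 0" "c n > 0" "x n = 0" | "c n = 0" "x n > 0"
      | "r > 0" "c n > 0" "x n > 0"
      using cone_step.IH cone_step.hyps(3) c0 by (auto simp: le_less)
    then show ?case
    proof cases
      case 1
      then show ?thesis using cone_step.IH by simp
    next
      case 2
      then have "?x \<in> cone ?R" using cone_step by (intro cone.cone_step) auto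
      then show ?thesis using 2 by simp
    next
      case 3
      have "x \<in> cone ?R" using cone_step.IH 3 by simp
      \<comment> \<open>Dehomogenising divides by the new height \<open>r * c n\<close>.\<close>
      then have "(\<lambda>i. 1 / (r * c n) * x i) \<in> cone ?R" using 3 by (intro cone_scale) auto
      then have "(\<lambda>i. dehom n c i + 1 / (r * c n) * x i) \<in> ?H"
        using 3 cone_step.hyps by (intro rays pts) auto
      moreover have "dehom n ?x = (\<lambda>i. dehom n c i + 1 / (r * c n) * x i)"
        using 3 by (auto simp: dehom_def field_simps)
      ultimately show ?thesis using 3 by simp
    next
      case 4
      then have "(\<lambda>i. dehom n x i + r / x n * c i) \<in> ?H"
        using cone_step by (intro ray) auto
      moreover have "dehom n ?x = (\<lambda>i. dehom n x i + r / x n * c i)"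
        using 4 by (auto simp: dehom_def field_simps)
      ultimately show ?thesis using 4 by simp
    next
      case 5
      define s where "s = x n + r * c n"
      have s: "s > 0" using 5 by (simp add: s_def add_pos_pos)
      \<comment> \<open>The dehomogenised sum is the average of the two dehomogenised points,
        weighted by their heights.\<close>
      have "(\<lambda>i. x n / s * dehom n x i + r * c n / s * dehom n c i) \<in> ?H"
        using 5 cone_step s pts[of c] unfolding mixed_int_hull_def
        by (intro convex_funD[OF convex_conv_hull])
          (auto simp: s_def simp flip: add_divide_distrib)
      moreover have "dehom n ?x = (\<lambda>i. x n / s * dehom n x i + r * c n / s * dehom n c i)"
        using 5 by (auto simp: dehom_def add_divide_distrib simp flip: s_def)
      ultimately show ?thesis using s by (simp add: s_def)
    qed
  qed
qed

text \<open>A mixed integer point of \<open>P\<close> is an integral combination of rays away from one whose integer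
  part lies in a fixed box. So the generators of the finitely many fibres of \<open>P\<close> over the integer
  points of that box, together with the rays of \<open>P\<close>, generate the hull.\<close>

lemma meyer:
  assumes S: "finite S" "S \<subseteq> intvec (Suc n)" "(\<lambda>i. - unit_vec n i) \<in> S" and p: "p \<le> n"
  obtains T where "finite T" "T \<subseteq> intvec (Suc n)" "mixed_int_hull p (slice n S) = slice n T"
proof -
  define M where "M = {z \<in> slice n S. \<forall>i<p. z i \<in> \<int>}"
  have H: "mixed_int_hull p (slice n S) = conv_hull M" by (simp add: mixed_int_hull_def M_def)
  have nonneg: "0 \<le> x n" if "x \<in> polar (Suc n) S" for x
  proof -
    have "lin (Suc n) (\<lambda>i. - unit_vec n i) x \<le> 0" using that S(3) by (auto simp: polar_def)
    then show ?thesis by (simp add: lin_uminus lin_commute[of _ "unit_vec n"] lin_unit_vec)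
  qed
  obtain G where G: "finite G" "G \<subseteq> intvec (Suc n)" "polar (Suc n) S = cone G"
    using minkowski[OF S(1,2)] by blast
  have Gnonneg: "0 \<le> g n" if "g \<in> G" for g
    using nonneg cone_base[OF that] G(3) by blast
  \<comment> \<open>One bound for all integer coordinates of the bounded part in
    \<open>cone_integral_split\<close>; \<open>X\<close> is the set of integer points of that
    box.\<close>
  define K where "K = (\<Sum>i<p. \<Sum>g\<in>G. \<bar>g i\<bar>)"
  define X where "X = {f :: nat \<Rightarrow> real. \<forall>i. (i \<in> {..<p} \<longrightarrow> f i \<in> {k \<in> \<int>. \<bar>k\<bar> \<le> K}) \<and>
    (i \<notin> {..<p} \<longrightarrow> f i = 0)}"
  have finX: "finite X"
    unfolding X_def by (intro finite_set_of_finite_funs finite_abs_int_segment) simp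
  \<comment> \<open>The homogenised equation \<open>x i = f i\<close>; with both signs added,
    \<open>F f\<close> describes the fibre over \<open>f\<close>.\<close>
  define row where "row = (\<lambda>(f :: nat \<Rightarrow> real) i k. unit_vec i k - f i * unit_vec n k)"
  define F where "F = (\<lambda>f. S \<union> row f ` {..<p} \<union> (\<lambda>i k. - row f i k) ` {..<p})"
  have lin_row: "lin (Suc n) (row f i) x = x i - f i * x n" if "i < p" for f i x
    using p that by (simp add: row_def lin_commute[of "Suc n" _ x] lin_diff lin_unit_vec)
  have memF: "x \<in> polar (Suc n) (F f) \<longleftrightarrow> x \<in> polar (Suc n) S \<and> (\<forall>i<p. x i = f i * x n)" for f x
  proof -
    have "x \<in> polar (Suc n) (F f) \<longleftrightarrow> x \<in> polar (Suc n) S \<and>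
        (\<forall>i<p. lin (Suc n) (row f i) x \<le> 0 \<and> lin (Suc n) (\<lambda>k. - row f i k) x \<le> 0)"
      unfolding polar_def F_def by blast
    moreover have "lin (Suc n) (row f i) x \<le> 0 \<and> lin (Suc n) (\<lambda>k. - row f i k) x \<le> 0
        \<longleftrightarrow> x i = f i * x n" if "i < p" for i
      using lin_row[OF that, of f x] by (auto simp: lin_uminus)
    ultimately show ?thesis by simp
  qed
  have "row f i \<in> intvec (Suc n)" if "f \<in> X" "i < p" for f i
    using that p by (auto simp: row_def X_def intvec_def euclid_def unit_vec_def)
  then have "finite (F f)" "F f \<subseteq> intvec (Suc n)" if "f \<in> X" for f
    using S that by (auto simp: F_def intro: uminus_intvec)
  then have "\<forall>f\<in>X. \<exists>G. finite G \<and> G \<subseteq> intvec (Suc n) \<and> polar (Suc n) (F f) = cone G"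
    by (intro ballI minkowski)
  from bchoice[OF this] obtain GF where
    GF: "\<forall>f\<in>X. finite (GF f) \<and> GF f \<subseteq> intvec (Suc n) \<and> polar (Suc n) (F f) = cone (GF f)" ..
  have coneGF: "polar (Suc n) (F f) = cone (GF f)" if "f \<in> X" for f using GF that by blast
  define T where "T = {g\<in>G. g n = 0} \<union> (\<Union>f\<in>X. GF f)"
  have T: "finite T" "T \<subseteq> intvec (Suc n)" using G GF finX by (auto simp: T_def)
  have memGF: "g \<in> polar (Suc n) S" "\<And>i. i < p \<Longrightarrow> g i = f i * g n" if "f \<in> X" "g \<in> GF f" for f g
    using memF[of g f] coneGF[OF that(1)] cone_base[OF that(2)] by blast+
  have TS: "g \<in> polar (Suc n) S" if "g \<in> T" for g
    using that memGF(1) G(3) cone_base by (auto simp: T_def)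
  have pts: "dehom n g \<in> conv_hull M" if g: "g \<in> T" "0 < g n" for g
  proof -
    obtain f where f: "f \<in> X" "g \<in> GF f" using g by (auto simp: T_def)
    have "dehom n g i \<in> \<int>" if "i < p" for i
      using memGF(2)[OF f that] g(2) p that f(1) by (auto simp: dehom_def X_def)
    then have "dehom n g \<in> M" using dehom_slice[of g n S] TS g by (simp add: M_def)
    then show ?thesis using conv_hull_superset by blast
  qed
  obtain T' where T': "finite T'" "T' \<subseteq> intvec (Suc n)" "cone T = polar (Suc n) T'"
    using weyl[OF T] by blast
  have "z \<in> slice n T'" if z: "z \<in> M" for z
  proof -
    let ?x = "z(n := 1)"
    have x: "?x \<in> cone G" using z G(3) by (simp add: M_def slice_def)
    obtain w u where wu: "w \<in> cone G" "u \<in> cone {g\<in>G. g n = 0}" "\<And>i. u i \<in> \<int>"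
      "?x = (\<lambda>i. w i + u i)" "\<And>i. \<bar>w i\<bar> \<le> (\<Sum>g\<in>G. \<bar>g i\<bar>)"
      by (rule cone_integral_split[of G n ?x, OF G(1,2) _ x]) (rule Gnonneg, assumption, simp, rule that)
    have un: "u n = 0" using wu(2) by (induction rule: cone.induct) auto
    have "w n = 1" using fun_cong[OF wu(4), of n] un by simp
    have wi: "w i \<in> \<int>" if "i < p" for i
    proof -
      have "w i = z i - u i" using fun_cong[OF wu(4), of i] that p by (simp split: if_splits)
      then show ?thesis using z that wu(3) by (simp add: M_def)
    qed
    have wK: "\<bar>w i\<bar> \<le> K" if "i < p" for i
    proof -
      have "(\<Sum>g\<in>G. \<bar>g i\<bar>) \<le> K" unfolding K_def
        using that by (intro member_le_sum[of i _ "\<lambda>i. \<Sum>g\<in>G. \<bar>g i\<bar>"]) (auto simp: sum_nonneg)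
      then show ?thesis using wu(5)[of i] by linarith
    qed
    \<comment> \<open>The integer coordinates of \<open>w\<close> select the fibre that contains
      it.\<close>
    define f where "f = (\<lambda>i. if i < p then w i else 0)"
    have f: "f \<in> X" using wi wK by (auto simp: X_def f_def)
    have "w \<in> polar (Suc n) (F f)" using wu(1) G(3) \<open>w n = 1\<close> by (simp add: memF f_def)
    then have "w \<in> cone T" using coneGF[OF f] f by (auto simp: T_def intro: cone_mono)
    moreover have "u \<in> cone T" using wu(2) by (auto simp: T_def intro: cone_mono)
    ultimately have "?x \<in> cone T" unfolding wu(4) by (intro cone_add)
    then show ?thesis using T'(3) z by (simp add: slice_def M_def)
  qed
  then have "conv_hull M \<subseteq> slice n T'" by (intro conv_hull_minimal convex_slice) auto
  moreover have "z \<in> conv_hull M" if z: "z \<in> slice n T'" for z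
  proof -
    let ?x = "z(n := 1)"
    have "?x \<in> cone T" using z T'(3) by (simp add: slice_def)
    then have "dehom n ?x \<in> mixed_int_hull p (slice n S)"
      using cone_dehom_hull[of T n S p ?x] T TS pts nonneg H by auto
    moreover have "dehom n ?x = z" using z by (auto simp: dehom_def slice_def euclid_def)
    ultimately show ?thesis by (simp add: H)
  qed
  ultimately show thesis using that[OF T'(1,2)] H by blast
qed

section \<open>The disjunctive closure\<close>

text \<open>An integer point misses the projection, so some projected constraint has
  \<open>c x + c n \<ge> 1\<close> there, that is \<open>- c x \<le> c n - 1\<close>. On the slice
  \<open>c x + c n \<le> 0\<close>, so all these inequalities fail.\<close>

lemma lattice_free_disjunction:
  assumes S: "finite S" "S \<subseteq> intvec (Suc n)" and p: "0 < p" "p \<le> n"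
    and free: "\<And>z. z \<in> slice n S \<Longrightarrow> \<exists>i<p. z i \<notin> \<int>"
  shows "\<exists>d \<delta>. is_disjunction p (2 ^ p) d \<delta> \<and>
    (\<forall>z\<in>slice n S. \<forall>i<2 ^ p. (\<Sum>j<p. of_int (d i j) * z j) > of_int (\<delta> i))"
proof -
  have "\<exists>S'. finite S' \<and> S' \<subseteq> intvec (Suc n) \<and> (\<forall>x. x \<in> polar (Suc n) S' \<longleftrightarrow>
      x \<in> euclid (Suc n) \<and> (\<exists>y\<in>polar (Suc n) S. \<forall>i. i \<notin> {p..<n} \<longrightarrow> y i = x i))"
    using S by (intro polar_projection) auto
  then obtain S' where S': "finite S'" "S' \<subseteq> intvec (Suc n)"
    and memS': "\<And>x. x \<in> polar (Suc n) S' \<longleftrightarrow>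
      x \<in> euclid (Suc n) \<and> (\<exists>y\<in>polar (Suc n) S. \<forall>i. i \<notin> {p..<n} \<longrightarrow> y i = x i)" by blast
  \<comment> \<open>The projected cone contains the whole axis of every eliminated coordinate, so
    its constraints vanish there. Coordinate \<open>n\<close> is kept because it carries the
    constants.\<close>
  have zero: "c j = 0" if c: "c \<in> S'" and j: "j \<in> {p..<n}" for c j
  proof -
    have "(\<lambda>_. 0) \<in> polar (Suc n) S" by (auto simp: polar_def euclid_def)
    then have *: "(\<lambda>i. s * unit_vec j i) \<in> polar (Suc n) S'" for s
      using j by (subst memS') (auto simp: euclid_def unit_vec_def intro!: bexI[of _ "\<lambda>_. 0"])
    have "lin (Suc n) c (\<lambda>i. s * unit_vec j i) \<le> 0" for s
      using *[of s] c by (auto simp: polar_def)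
    from this[of 1] this[of "-1"] show ?thesis using j unfolding lin_scale by (simp add: lin_unit_vec)
  qed
  have lin_eq: "lin (Suc n) c v = (\<Sum>j<p. c j * v j) + c n * v n" if "c \<in> S'" for c v
  proof -
    have "lin n c v = (\<Sum>j<p. c j * v j)"
      unfolding lin_def using p zero[OF that] by (intro sum.mono_neutral_right) auto
    then show ?thesis by (simp add: lin_Suc)
  qed
  define D where "D = (\<lambda>(c :: nat \<Rightarrow> real) j. - \<lfloor>c j\<rfloor>)"
  define \<Delta> where "\<Delta> = (\<lambda>c :: nat \<Rightarrow> real. \<lfloor>c n\<rfloor> - 1)"
  have fl: "of_int \<lfloor>c j\<rfloor> = c j" if "c \<in> S'" for c j
    using subsetD[OF S'(2) that] by (simp add: intvec_def)
  have D: "(\<Sum>j<p. of_int (D c j) * z j) = - (\<Sum>j<p. c j * z j)" if "c \<in> S'" for c z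
    by (simp add: D_def sum_negf fl[OF that] del: of_int_floor_cancel)
  have "covers p D \<Delta> S'"
    unfolding covers_def
  proof
    fix x :: "nat \<Rightarrow> int"
    define v where "v = (\<lambda>i. if i < p then of_int (x i) else if i = n then 1 else 0 :: real)"
    have "v \<notin> polar (Suc n) S'"
    proof
      assume "v \<in> polar (Suc n) S'"
      then have "\<exists>y\<in>polar (Suc n) S. \<forall>i. i \<notin> {p..<n} \<longrightarrow> y i = v i" by (simp only: memS')
      then obtain y where y: "y \<in> polar (Suc n) S" "\<And>i. i \<notin> {p..<n} \<Longrightarrow> y i = v i" by blast
      have "y n = 1" using y(2)[of n] p by (simp add: v_def)
      then have "y(n := 0, n := 1) = y" by auto
      moreover have "y(n := 0) \<in> euclid n" using y(1) by (auto simp: polar_def euclid_def)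
      ultimately have "y(n := 0) \<in> slice n S" using y(1) by (simp add: slice_def)
      then obtain i where "i < p" "(y(n := 0)) i \<notin> \<int>" using free by blast
      then show False using y(2)[of i] p by (auto simp: v_def split: if_splits)
    qed
    moreover have "v \<in> euclid (Suc n)" using p by (auto simp: v_def euclid_def)
    ultimately obtain c where c: "c \<in> S'" "lin (Suc n) c v > 0" by (auto simp: polar_def not_le)
    have "real_of_int (\<Sum>j<p. D c j * x j) = - (\<Sum>j<p. c j * v j)"
      using D[OF c(1), of v] by (simp add: v_def)
    also have "\<dots> < c n" using c p by (simp add: lin_eq v_def)
    also have "c n = of_int \<lfloor>c n\<rfloor>" using fl[OF c(1), of n] by (rule sym)
    finally have "(\<Sum>j<p. D c j * x j) < \<lfloor>c n\<rfloor>" by (simp only: of_int_less_iff)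
    then show "\<exists>c\<in>S'. (\<Sum>j<p. D c j * x j) \<le> \<Delta> c" using c(1) by (auto simp: \<Delta>_def)
  qed
  then obtain K where K: "K \<subseteq> S'" "covers p D \<Delta> K" "card K \<le> 2 ^ p"
    using doignon[OF S'(1)] by blast
  have finK: "finite K" using K S' finite_subset by blast
  have "K \<noteq> {}" using K(2) by (auto simp: covers_def)
  then have K0: "0 < card K" using finK by (simp add: card_gt_0_iff)
  obtain h where h: "bij_betw h {0..<card K} K" using ex_bij_betw_nat_finite[OF finK] by blast
  \<comment> \<open>Exactly \<open>2 ^ p\<close> inequalities are required, so the family is padded
    by repeating one of them.\<close>
  define e where "e = (\<lambda>i. if i < card K then h i else h 0)"
  have eK: "e i \<in> K" for i using bij_betwE[OF h] K0 by (auto simp: e_def)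
  have surj: "\<exists>i<2 ^ p. e i = c" if "c \<in> K" for c
  proof -
    obtain i where "i < card K" "h i = c" using h \<open>c \<in> K\<close> unfolding bij_betw_def by force
    then show ?thesis using K(3) by (intro exI[of _ i]) (auto simp: e_def)
  qed
  have "is_disjunction p (2 ^ p) (\<lambda>i. D (e i)) (\<lambda>i. \<Delta> (e i))"
    unfolding is_disjunction_def
  proof (intro conjI allI)
    show "2 \<le> (2::nat) ^ p" using p(1) by (cases p) auto
    fix x :: "nat \<Rightarrow> int"
    obtain c where "c \<in> K" "(\<Sum>j<p. D c j * x j) \<le> \<Delta> c" using K(2) by (auto simp: covers_def)
    then show "\<exists>i<2 ^ p. (\<Sum>j<p. D (e i) j * x j) \<le> \<Delta> (e i)" using surj by blast
  qed
  moreover have "(\<Sum>j<p. of_int (D (e i) j) * z j) > of_int (\<Delta> (e i))" if z: "z \<in> slice n S" for z i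
  proof -
    have e: "e i \<in> S'" using eK K by blast
    have "z(n := 1) \<in> polar (Suc n) S" using z by (simp add: slice_def)
    then have "z(n := 1) \<in> polar (Suc n) S'"
      unfolding memS' by (auto simp only: polar_def)
    then have "lin (Suc n) (e i) (z(n := 1)) \<le> 0" using e by (simp add: polar_def)
    then have "(\<Sum>j<p. e i j * z j) + e i n \<le> 0" using lin_eq[OF e, of "z(n := 1)"] p by simp
    then show ?thesis using D[OF e, of z] unfolding \<Delta>_def by linarith
  qed
  ultimately show ?thesis by blast
qed

lemma convex_disj_closure:
  assumes "convex_fun C"
  shows "convex_fun (disj_closure p q k C)"
proof -
  have "s * a + t * b \<le> \<gamma>" if "a \<le> \<gamma>" "b \<le> \<gamma>" "0 \<le> s" "0 \<le> t" "s + t = 1" for a b s t \<gamma> :: real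
    using convex_bound_le[of a \<gamma> b s t] that by simp
  then show ?thesis using assms by (auto simp: convex_fun_def disj_closure_def lin_comb)
qed

text \<open>Convexity of the closure reduces the claim to single mixed integer points; there the
  floors are exact and the disjunction applies.\<close>

lemma mixed_int_hull_subset_disj_closure:
  assumes "convex_fun C"
  shows "mixed_int_hull p C \<subseteq> disj_closure p q k C"
  unfolding mixed_int_hull_def
proof (intro conv_hull_minimal convex_disj_closure assms subsetI)
  fix z assume z: "z \<in> {z \<in> C. \<forall>i<p. z i \<in> \<int>}"
  have "lin (p + q) a z \<le> \<gamma>" if cut: "disj_cut p q k C a \<gamma>" for a \<gamma>
  proof (rule ccontr)
    assume "\<not> lin (p + q) a z \<le> \<gamma>"
    then obtain d \<delta> where dis: "is_disjunction p k d \<delta>"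
      and gt: "\<And>i. i < k \<Longrightarrow> (\<Sum>j<p. of_int (d i j) * z j) > of_int (\<delta> i)"
      using cut z unfolding disj_cut_def by (auto simp: not_le)
    obtain i where i: "i < k" "(\<Sum>j<p. d i j * \<lfloor>z j\<rfloor>) \<le> \<delta> i"
      using spec[OF conjunct2[OF dis[unfolded is_disjunction_def]], of "\<lambda>j. \<lfloor>z j\<rfloor>"] by blast
    have "(\<Sum>j<p. of_int (d i j) * z j) = real_of_int (\<Sum>j<p. d i j * \<lfloor>z j\<rfloor>)"
      using z by simp
    also have "\<dots> \<le> of_int (\<delta> i)" using i(2) by (simp only: of_int_le_iff)
    finally show False using gt[OF i(1)] by simp
  qed
  then show "z \<in> disj_closure p q k C" using z by (simp add: disj_closure_def)
qed

theorem theorem2p6: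
  fixes p q :: nat and P :: "(nat \<Rightarrow> real) set"
  assumes "rational_polyhedron (p+q) P"
  shows "mixed_int_hull p P = disj_closure p q (2^p) P"
proof
  define n where "n = p + q"
  obtain S where S: "finite S" "S \<subseteq> intvec (Suc n)" "(\<lambda>i. - unit_vec n i) \<in> S" "P = slice n S"
    using rational_polyhedron_slice assms unfolding n_def by blast
  show "mixed_int_hull p P \<subseteq> disj_closure p q (2^p) P"
    unfolding S(4) by (intro mixed_int_hull_subset_disj_closure convex_slice)
  show "disj_closure p q (2^p) P \<subseteq> mixed_int_hull p P"
  \<comment> \<open>\<open>2 ^ 0\<close> is too small for a disjunction, but without integer
    coordinates the hull already contains \<open>P\<close>.\<close>
  proof (cases "p = 0")
    case True
    then show ?thesis using conv_hull_superset[of P] by (auto simp: mixed_int_hull_def disj_closure_def)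
  next
    case False
    obtain T where T: "T \<subseteq> intvec (Suc n)" "mixed_int_hull p P = slice n T"
      using meyer[OF S(1-3), of p] S(4) unfolding n_def by (metis le_add1)
    show ?thesis
    proof (rule subsetI, rule ccontr)
      fix z assume z: "z \<in> disj_closure p q (2^p) P" and "z \<notin> mixed_int_hull p P"
      have zP: "z \<in> P" using z by (simp add: disj_closure_def)
      then obtain c where c: "c \<in> T" "lin n c z + c n > 0"
        using \<open>z \<notin> mixed_int_hull p P\<close> T(2) S(4) by (auto simp: mem_slice not_le)
      obtain g where g: "g \<in> \<rat>" "- c n < g" "g < lin n c z"
        using Rats_dense_in_real[of "- c n" "lin n c z"] c(2) by auto
      obtain a b where ab: "b > 0" "g = of_int a / of_int b" using g(1) by (auto elim: Rats_cases')
      \<comment> \<open>The constraint \<open>g \<le> c x\<close>, multiplied by the denominator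
        \<open>b\<close> and homogenised.\<close>
      define v where "v = (\<lambda>i. if i = n then of_int a else - (of_int b * c i))"
      have cint: "c \<in> intvec (Suc n)" using c T by blast
      have v: "v \<in> intvec (Suc n)" using cint by (auto simp: v_def intvec_def euclid_def)
      have lin_v: "lin n v x + v n \<le> 0 \<longleftrightarrow> g \<le> lin n c x" for x
      proof -
        have "lin n v x = - (of_int b * lin n c x)"
          by (simp add: lin_def v_def sum_distrib_left mult.assoc sum_negf)
        then show ?thesis using ab by (simp add: v_def pos_divide_le_eq mult.commute)
      qed
      have R: "x \<in> slice n (insert v S) \<longleftrightarrow> x \<in> P \<and> g \<le> lin n c x" for x
        using lin_v by (auto simp: S(4) mem_slice)
      have "\<exists>i<p. x i \<notin> \<int>" if x: "x \<in> slice n (insert v S)" for x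
      proof (rule ccontr)
        assume "\<not> (\<exists>i<p. x i \<notin> \<int>)"
        then have "x \<in> {z \<in> P. \<forall>i<p. z i \<in> \<int>}" using x R by simp
        then have "x \<in> mixed_int_hull p P"
          unfolding mixed_int_hull_def by (rule subsetD[OF conv_hull_superset])
        then have "lin n c x + c n \<le> 0" using T(2) c(1) by (simp add: mem_slice)
        then show False using x R g(2) by auto
      qed
      then have "\<exists>d \<delta>. is_disjunction p (2 ^ p) d \<delta> \<and>
          (\<forall>x\<in>slice n (insert v S). \<forall>i<2 ^ p. (\<Sum>j<p. of_int (d i j) * x j) > of_int (\<delta> i))"
        using S(1,2) v False n_def by (intro lattice_free_disjunction) auto
      then obtain d \<delta> where dis: "is_disjunction p (2 ^ p) d \<delta>"
        and gt: "\<forall>x\<in>slice n (insert v S). \<forall>i<2 ^ p. (\<Sum>j<p. of_int (d i j) * x j) > of_int (\<delta> i)"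
        by (elim exE conjE)
      have "\<forall>x\<in>P. g < lin n c x \<longrightarrow> (\<forall>i<2 ^ p. (\<Sum>j<p. of_int (d i j) * x j) > of_int (\<delta> i))"
        using gt by (simp add: R)
      then have "disj_cut p q (2 ^ p) P c g"
        unfolding disj_cut_def n_def[symmetric] using zP g(3) dis by (intro conjI bexI exI)
      then have "lin n c z \<le> g" using z unfolding disj_closure_def n_def by blast
      then show False using g(3) by simp
    qed
  qed
qed

end
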